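(* Let $P$ be a finite poset on a ground set $V$ and let $S\subseteq V$. Put $U=U[S]\setminus S$ and $D=D[S]\setminus S$. Then \[ \dim P\le 2\big(\dim P[D[S]\cup U[S]]+\dim P[V\setminus S]\big) \] and \[ \dim P[D[S]\cup U[S]]\le \dim P[D[S]]+\dim P[U[S]]+\dim P[D\cup U]. \]
   Context: For $S\subseteq V$, $U[S]=\{x: y\le_P x\text{ for some }y\in S\}$ and $D[S]=\{x: x\le_P y\text{ for some }y\in S\}$. $P[X]$ denotes the subposet induced on $X$. The dimension $\dim P$ is the minimum number of linear orders on the ground set whose intersection is the order of $P$. *)

theory Defs
  imports Main
begin

definition up_set :: "'a rel \<Rightarrow> 'a set \<Rightarrow> 'a set" where
  "up_set P S = {x. \<exists>y\<in>S. (y, x) \<in> P}"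

definition down_set :: "'a rel \<Rightarrow> 'a set \<Rightarrow> 'a set" where
  "down_set P S = {x. \<exists>y\<in>S. (x, y) \<in> P}"

definition subposet :: "'a rel \<Rightarrow> 'a set \<Rightarrow> 'a rel" where
  "subposet P X = P \<inter> X \<times> X"

text \<open>
  The intersection is taken inside \<open>A \<times> A\<close> because \<open>\<Inter>{}\<close> is \<open>UNIV\<close> in HOL.
  A nonempty ground set needs at least one linear order, so a nonempty chain (in particular a
  single point) has dimension 1, as usual; the poset on the empty ground set has dimension 0.
\<close>

definition realizer :: "'a set \<Rightarrow> 'a rel \<Rightarrow> 'a rel set \<Rightarrow> bool" where
  "realizer A P L \<longleftrightarrow>
     finite L \<and> (A \<noteq> {} \<longrightarrow> L \<noteq> {}) \<and> (\<forall>l\<in>L. linear_order_on A l) \<and> (A \<times> A) \<inter> \<Inter>L = P"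

text \<open>
  The ground set is an explicit argument. Every partial order on a finite set has a realizer,
  so there the minimum exists.
\<close>

definition poset_dim :: "'a set \<Rightarrow> 'a rel \<Rightarrow> nat" where
  "poset_dim A P = (LEAST n. \<exists>L. realizer A P L \<and> card L = n)"

abbreviation induced_dim :: "'a rel \<Rightarrow> 'a set \<Rightarrow> nat" where
  "induced_dim P X \<equiv> poset_dim X (subposet P X)"

end

theory Submission
  imports Defs
begin

text \<open>
  A family of linear extensions of \<open>P\<close> realizes \<open>P\<close> as soon as every non-pair \<open>(x, y) \<notin> P\<close> is
  missed by one of them. A linear extension of an induced subposet extends to one of \<open>P\<close>, so a
  family of subsets contributes the sum of its dimensions and takes care of all non-pairs inside
  one of the subsets.

  For the second inequality the three subsets cover every pair: a pair lying neither in \<open>D[S]\<close>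
  nor in \<open>U[S]\<close> avoids \<open>S\<close>, because \<open>S \<subseteq> D[S] \<inter> U[S]\<close>. For the first, the pairs left over have one element in
  \<open>S\<close> and the other outside \<open>D[S] \<union> U[S]\<close>; two more extensions, one with \<open>D[S]\<close> at the bottom and
  one with \<open>U[S]\<close> at the top, handle them. If both summands are positive, then adding \<open>2\<close> is at
  most doubling; otherwise \<open>S\<close> is empty or all of \<open>V\<close>.
\<close>

section \<open>Partial orders and their linear extensions\<close>

lemma partial_order_onI:
  assumes "r \<subseteq> A \<times> A" "\<And>x. x \<in> A \<Longrightarrow> (x, x) \<in> r"
    and "\<And>x y z. (x, y) \<in> r \<Longrightarrow> (y, z) \<in> r \<Longrightarrow> (x, z) \<in> r"
    and "\<And>x y. (x, y) \<in> r \<Longrightarrow> (y, x) \<in> r \<Longrightarrow> x = y"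
  shows "partial_order_on A r"
  using assms unfolding partial_order_on_def preorder_on_def
  by (intro conjI refl_onI transI antisymI)

lemma partial_order_on_subposet:
  assumes "partial_order_on V P" "X \<subseteq> V"
  shows "partial_order_on X (subposet P X)"
proof -
  note P0 = refl_onD[OF partial_order_onD(1)[OF assms(1)]]
    and Pt = transD[OF partial_order_onD(2)[OF assms(1)]]
    and Pa = antisymD[OF partial_order_onD(3)[OF assms(1)]]
  show ?thesis
  proof (rule partial_order_onI)
    show "(x, z) \<in> subposet P X" if "(x, y) \<in> subposet P X" "(y, z) \<in> subposet P X" for x y z
      using that Pt[of x y z] by (simp add: subposet_def)
    show "x = y" if "(x, y) \<in> subposet P X" "(y, x) \<in> subposet P X" for x y
      using that Pa[of x y] by (simp add: subposet_def)
  qed (use assms(2) P0 in \<open>auto simp: subposet_def\<close>)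
qed

lemma subposet_subposet: "X \<subseteq> W \<Longrightarrow> subposet (subposet P W) X = subposet P X"
  by (auto simp: subposet_def)

text \<open>The relation is the transitive closure of \<open>P \<union> l\<close>. Since
  \<open>P\<close> between points of \<open>X\<close> is already contained in \<open>l\<close>, a
  chain alternating between \<open>P\<close> and \<open>l\<close> collapses to a single
  \<open>l\<close>-step between two \<open>P\<close>-steps.\<close>

lemma partial_order_on_add_linear:
  assumes P: "partial_order_on V P" and X: "X \<subseteq> V"
    and l: "partial_order_on X l" and sub: "subposet P X \<subseteq> l"
  shows "partial_order_on V (P \<union> P O l O P)"
proof -
  note P0 = partial_order_onD(4)[OF P] refl_onD[OF partial_order_onD(1)[OF P]]
    and Pt = transD[OF partial_order_onD(2)[OF P]]
    and Pa = antisymD[OF partial_order_onD(3)[OF P]]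
  note l0 = partial_order_onD(4)[OF l] refl_onD[OF partial_order_onD(1)[OF l]]
    and lt = transD[OF partial_order_onD(2)[OF l]]
    and la = antisymD[OF partial_order_onD(3)[OF l]]
  have step: "(b, c) \<in> l" if "(a, b) \<in> l" "(b, c) \<in> P" "(c, d) \<in> l" for a b c d
    using that l0(1) sub by (auto simp: subposet_def)
  have chain: "(a, d) \<in> l" if "(a, b) \<in> l" "(b, c) \<in> P" "(c, d) \<in> l" for a b c d
    using step[OF that] that lt by blast
  \<comment> \<open>The cycle yields \<open>(b, a)\<close> in \<open>P\<close>, hence in
    \<open>l\<close> because both points lie in \<open>X\<close>. Antisymmetry of \<open>l\<close>
    gives \<open>a = b\<close>, which leaves a cycle inside \<open>P\<close>.\<close>
  have mixed: "x = y" if "(x, y) \<in> P" "(y, a) \<in> P" "(a, b) \<in> l" "(b, x) \<in> P" for x y a b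
  proof -
    have "(b, a) \<in> P" using that Pt by blast
    then have "a = b" using that(3) l0(1) sub la by (auto simp: subposet_def)
    then show ?thesis using that Pt Pa by blast
  qed
  show ?thesis
  proof (rule partial_order_onI)
    show "P \<union> P O l O P \<subseteq> V \<times> V" using P0(1) by blast
    show "(x, x) \<in> P \<union> P O l O P" if "x \<in> V" for x using P0(2) that by blast
    show "(x, z) \<in> P \<union> P O l O P"
      if "(x, y) \<in> P \<union> P O l O P" "(y, z) \<in> P \<union> P O l O P" for x y z
      using that
    proof (elim UnE)
      assume "(x, y) \<in> P O l O P" "(y, z) \<in> P O l O P"
      then obtain a b c d where 1: "(x, a) \<in> P" "(a, b) \<in> l" "(b, y) \<in> P"
        "(y, c) \<in> P" "(c, d) \<in> l" "(d, z) \<in> P" by blast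
      then have "(a, d) \<in> l" using chain Pt by blast
      then show ?thesis using 1 by blast
    qed (use Pt in blast)+
    show "x = y" if "(x, y) \<in> P \<union> P O l O P" "(y, x) \<in> P \<union> P O l O P" for x y
      using that
    proof (elim UnE)
      assume "(x, y) \<in> P O l O P" "(y, x) \<in> P O l O P"
      then obtain a b c d where 1: "(x, a) \<in> P" "(a, b) \<in> l" "(b, y) \<in> P"
        "(y, c) \<in> P" "(c, d) \<in> l" "(d, x) \<in> P" by blast
      \<comment> \<open>Through \<open>y\<close> and \<open>x\<close>, the pairs
        \<open>(b, c)\<close> and \<open>(d, a)\<close> lie in \<open>P\<close>, so
        \<open>a\<close>, \<open>b\<close>, \<open>c\<close>, \<open>d\<close> form a cycle in
        \<open>l\<close> and coincide. Then \<open>x\<close> is below \<open>y\<close> in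
        \<open>P\<close>, and \<open>mixed\<close> applies.\<close>
      have bc: "(b, c) \<in> l" "(b, c) \<in> P" and da: "(d, a) \<in> l"
        using 1 step Pt by blast+
      then have "a = b" using 1 lt la by meson
      then show ?thesis using 1 mixed[of x y c d] Pt by blast
    qed (use mixed Pa in blast)+
  qed
qed

text \<open>Szpilrajn's theorem in the finite case: a maximal partial order containing
  \<open>P\<close> is total, because an incomparable pair could still be added.\<close>

lemma linear_order_extension:
  assumes fin: "finite V" and P: "partial_order_on V P"
  shows "\<exists>l. linear_order_on V l \<and> P \<subseteq> l"
proof -
  let ?E = "{Q. partial_order_on V Q \<and> P \<subseteq> Q}"
  have "?E \<subseteq> Pow (V \<times> V)" by (blast dest: partial_order_onD(4))
  then have "finite ?E" using fin by (meson finite_Pow_iff finite_SigmaI finite_subset)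
  moreover have "?E \<noteq> {}" using P by auto
  ultimately obtain Q where Q: "partial_order_on V Q" "P \<subseteq> Q"
    and max: "\<And>R. partial_order_on V R \<Longrightarrow> P \<subseteq> R \<Longrightarrow> Q \<subseteq> R \<Longrightarrow> Q = R"
    using finite_has_maximal[of ?E] by auto
  have "(x, y) \<in> Q" if xy: "x \<in> V" "y \<in> V" "(y, x) \<notin> Q" for x y
  proof -
    \<comment> \<open>The two-point chain with \<open>x\<close> below \<open>y\<close> is glued into
      \<open>Q\<close>; by maximality \<open>Q\<close> already contains it.\<close>
    let ?l = "{(x, x), (y, y), (x, y)}"
    have refl: "(x, x) \<in> Q" "(y, y) \<in> Q" using refl_onD[OF partial_order_onD(1)[OF Q(1)]] xy by blast+
    have "partial_order_on {x, y} ?l"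
      by (rule partial_order_onI) auto
    moreover have "subposet Q {x, y} \<subseteq> ?l" using xy by (auto simp: subposet_def)
    ultimately have "partial_order_on V (Q \<union> Q O ?l O Q)"
      using partial_order_on_add_linear[OF Q(1), of "{x, y}" ?l] xy by blast
    then have "Q = Q \<union> Q O ?l O Q" using max Q(2) by blast
    then show ?thesis using refl by blast
  qed
  then have "total_on V Q" unfolding total_on_def by blast
  then show ?thesis using Q unfolding linear_order_on_def by blast
qed

lemma linear_order_extension_of_subposet:
  assumes "finite V" and P: "partial_order_on V P" and X: "X \<subseteq> V"
    and l: "partial_order_on X l" and sub: "subposet P X \<subseteq> l"
  shows "\<exists>m. linear_order_on V m \<and> P \<subseteq> m \<and> l \<subseteq> m"
proof -
  obtain m where m: "linear_order_on V m" "P \<union> P O l O P \<subseteq> m"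
    using linear_order_extension[OF assms(1) partial_order_on_add_linear[OF P X l sub]] by blast
  have "l \<subseteq> P O l O P"
    using refl_onD[OF partial_order_onD(1)[OF P]] partial_order_onD(4)[OF l] X by blast
  then show ?thesis using m by blast
qed

text \<open>No pair of \<open>P\<close> leads from \<open>V - D\<close> into \<open>D\<close>, so
  putting all of \<open>D\<close> below the rest creates no cycle.\<close>

lemma linear_order_extension_downset:
  assumes "finite V" and P: "partial_order_on V P" and D: "D \<subseteq> V"
    and down: "\<And>x y. (x, y) \<in> P \<Longrightarrow> y \<in> D \<Longrightarrow> x \<in> D"
  shows "\<exists>m. linear_order_on V m \<and> P \<subseteq> m \<and> D \<times> (V - D) \<subseteq> m"
proof -
  note P0 = partial_order_onD(4)[OF P] refl_onD[OF partial_order_onD(1)[OF P]]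
    and Pt = transD[OF partial_order_onD(2)[OF P]]
    and Pa = antisymD[OF partial_order_onD(3)[OF P]]
  have "partial_order_on V (P \<union> D \<times> (V - D))"
  proof (rule partial_order_onI)
    show "(x, z) \<in> P \<union> D \<times> (V - D)"
      if "(x, y) \<in> P \<union> D \<times> (V - D)" "(y, z) \<in> P \<union> D \<times> (V - D)" for x y z
      using that Pt[of x y z] down[of x y] down[of y z] P0(1) by blast
    show "x = y" if "(x, y) \<in> P \<union> D \<times> (V - D)" "(y, x) \<in> P \<union> D \<times> (V - D)" for x y
      using that Pa[of x y] down[of x y] down[of y x] by blast
  qed (use P0 D in blast)+
  then show ?thesis using linear_order_extension[OF assms(1)] by blast
qed

section \<open>Realizers and dimension\<close>

lemma linear_order_on_antisym:
  "linear_order_on V l \<Longrightarrow> (x, y) \<in> l \<Longrightarrow> x \<noteq> y \<Longrightarrow> (y, x) \<notin> l"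
  unfolding linear_order_on_def partial_order_on_def by (auto dest: antisymD)

text \<open>The set of all linear extensions works: for a non-pair \<open>(x, y)\<close> some
  extension places \<open>y\<close> below \<open>x\<close>. This guarantees that the
  \<open>LEAST\<close> in \<open>poset_dim\<close> is attained.\<close>

lemma realizer_exists:
  assumes fin: "finite V" and P: "partial_order_on V P"
  shows "\<exists>L. realizer V P L"
proof -
  let ?L = "{l. linear_order_on V l \<and> P \<subseteq> l}"
  have "?L \<subseteq> Pow (V \<times> V)"
    unfolding linear_order_on_def by (blast dest: partial_order_onD(4))
  then have "finite ?L" using fin by (meson finite_Pow_iff finite_SigmaI finite_subset)
  moreover have "?L \<noteq> {}" using linear_order_extension[OF fin P] by blast
  moreover have "\<exists>l\<in>?L. (x, y) \<notin> l" if xy: "x \<in> V" "y \<in> V" "(x, y) \<notin> P" for x y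
  proof -
    have ne: "x \<noteq> y" using xy refl_onD[OF partial_order_onD(1)[OF P]] by blast
    have "partial_order_on {x, y} {(x, x), (y, y), (y, x)}"
      by (rule partial_order_onI) auto
    moreover have "subposet P {x, y} \<subseteq> {(x, x), (y, y), (y, x)}"
      using xy by (auto simp: subposet_def)
    ultimately obtain l where "linear_order_on V l" "P \<subseteq> l" "(y, x) \<in> l"
      using linear_order_extension_of_subposet[OF fin P, of "{x, y}"] xy by blast
    then show ?thesis using linear_order_on_antisym[of V l y x] ne by blast
  qed
  moreover have "P \<subseteq> V \<times> V" by (rule partial_order_onD(4)[OF P])
  ultimately have "realizer V P ?L" unfolding realizer_def by blast
  then show ?thesis by blast
qed

lemma poset_dim_realizer:
  assumes "finite V" "partial_order_on V P"
  obtains L where "realizer V P L" "card L = poset_dim V P"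
proof -
  have "\<exists>n L. realizer V P L \<and> card L = n" using realizer_exists[OF assms] by blast
  from LeastI_ex[OF this] show thesis using that unfolding poset_dim_def by blast
qed

lemma poset_dim_pos:
  assumes "finite V" "partial_order_on V P" "V \<noteq> {}"
  shows "poset_dim V P > 0"
proof -
  obtain L where "realizer V P L" "card L = poset_dim V P"
    by (rule poset_dim_realizer[OF assms(1,2)])
  then show ?thesis using assms(3) card_gt_0_iff[of L] by (simp add: realizer_def)
qed

lemma poset_dim_le_card:
  assumes P: "partial_order_on V P" and "finite L" "V \<noteq> {} \<Longrightarrow> L \<noteq> {}"
    and "\<And>l. l \<in> L \<Longrightarrow> linear_order_on V l \<and> P \<subseteq> l"
    and "\<And>x y. x \<in> V \<Longrightarrow> y \<in> V \<Longrightarrow> (x, y) \<notin> P \<Longrightarrow> \<exists>l\<in>L. (x, y) \<notin> l"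
  shows "poset_dim V P \<le> card L"
proof -
  have "(V \<times> V) \<inter> \<Inter>L = P"
  proof
    show "(V \<times> V) \<inter> \<Inter>L \<subseteq> P" using assms(5) by fast
    show "P \<subseteq> (V \<times> V) \<inter> \<Inter>L" using assms(4) partial_order_onD(4)[OF P] by blast
  qed
  then have "realizer V P L" using assms(2-4) by (simp add: realizer_def)
  then show ?thesis unfolding poset_dim_def by (blast intro: Least_le)
qed

text \<open>Each order of a minimum realizer of the induced poset is extended to a linear extension
  of \<open>P\<close>. Distinct orders may get the same extension, hence only an inequality for the
  cardinality.\<close>

lemma realizer_of_subposet_lift:
  assumes fin: "finite V" and P: "partial_order_on V P" and X: "X \<subseteq> V"
  obtains L where "finite L" "card L \<le> induced_dim P X" "X \<noteq> {} \<longrightarrow> L \<noteq> {}"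
    and "\<forall>l\<in>L. linear_order_on V l \<and> P \<subseteq> l"
    and "\<forall>x\<in>X. \<forall>y\<in>X. (x, y) \<notin> P \<longrightarrow> (\<exists>l\<in>L. (x, y) \<notin> l)"
proof -
  obtain K where K: "realizer X (subposet P X) K" "card K = induced_dim P X"
    using poset_dim_realizer[OF finite_subset[OF X fin] partial_order_on_subposet[OF P X]] .
  have "\<exists>m. linear_order_on V m \<and> P \<subseteq> m \<and> l \<subseteq> m" if "l \<in> K" for l
    using linear_order_extension_of_subposet[OF fin P X, of l] K(1) that
    unfolding realizer_def linear_order_on_def by blast
  then obtain f where f: "\<And>l. l \<in> K \<Longrightarrow> linear_order_on V (f l) \<and> P \<subseteq> f l \<and> l \<subseteq> f l"
    by metis
  show thesis
  proof
    show "finite (f ` K)" "X \<noteq> {} \<longrightarrow> f ` K \<noteq> {}"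
      using K(1) by (auto simp: realizer_def)
    show "card (f ` K) \<le> induced_dim P X"
      using K card_image_le[of K f] by (simp add: realizer_def)
    show "\<forall>l\<in>f ` K. linear_order_on V l \<and> P \<subseteq> l" using f by blast
    have "\<exists>l\<in>f ` K. (x, y) \<notin> l" if xy: "x \<in> X" "y \<in> X" "(x, y) \<notin> P" for x y
    proof -
      obtain l where l: "l \<in> K" "(x, y) \<notin> l"
        using K(1) xy unfolding realizer_def subposet_def by blast
      have lin: "linear_order_on X l" using K(1) l(1) unfolding realizer_def by blast
      have ne: "x \<noteq> y" using xy X refl_onD[OF partial_order_onD(1)[OF P]] by blast
      \<comment> \<open>By totality, an order that misses \<open>(x, y)\<close> contains the
        reversed pair; its extension inherits that pair and so misses \<open>(x, y)\<close>
        too.\<close>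
      then have "(y, x) \<in> l"
        using lin l(2) xy unfolding linear_order_on_def total_on_def by blast
      then have "(x, y) \<notin> f l" using f[OF l(1)] linear_order_on_antisym[of V "f l" y x] ne by blast
      then show ?thesis using l(1) by blast
    qed
    then show "\<forall>x\<in>X. \<forall>y\<in>X. (x, y) \<notin> P \<longrightarrow> (\<exists>l\<in>f ` K. (x, y) \<notin> l)" by blast
  qed
qed

section \<open>The two dimension bounds\<close>

lemma poset_dim_le_add_two:
  assumes fin: "finite V" and P: "partial_order_on V P" and S: "S \<subseteq> V"
  shows "poset_dim V P
    \<le> induced_dim P (down_set P S \<union> up_set P S) + induced_dim P (V - S) + 2"
proof -
  let ?D = "down_set P S" and ?U = "up_set P S"
  note P0 = partial_order_onD(4)[OF P] refl_onD[OF partial_order_onD(1)[OF P]]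
    and Pt = transD[OF partial_order_onD(2)[OF P]]
  have sub: "?D \<subseteq> V" "?U \<subseteq> V" "S \<subseteq> ?D" "S \<subseteq> ?U"
    using P0 S by (auto simp: down_set_def up_set_def)
  then have DU: "?D \<union> ?U \<subseteq> V" by blast
  obtain K where K: "finite K" "card K \<le> induced_dim P (?D \<union> ?U)"
    "?D \<union> ?U \<noteq> {} \<longrightarrow> K \<noteq> {}" "\<forall>l\<in>K. linear_order_on V l \<and> P \<subseteq> l"
    "\<forall>x\<in>?D \<union> ?U. \<forall>y\<in>?D \<union> ?U. (x, y) \<notin> P \<longrightarrow> (\<exists>l\<in>K. (x, y) \<notin> l)"
    by (rule realizer_of_subposet_lift[OF fin P DU])
  obtain L where L: "finite L" "card L \<le> induced_dim P (V - S)"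
    "V - S \<noteq> {} \<longrightarrow> L \<noteq> {}" "\<forall>l\<in>L. linear_order_on V l \<and> P \<subseteq> l"
    "\<forall>x\<in>V - S. \<forall>y\<in>V - S. (x, y) \<notin> P \<longrightarrow> (\<exists>l\<in>L. (x, y) \<notin> l)"
    by (rule realizer_of_subposet_lift[OF fin P Diff_subset])
  have "x \<in> ?D" if "(x, y) \<in> P" "y \<in> ?D" for x y
    using that Pt[of x y] by (auto simp: down_set_def)
  then obtain d where d: "linear_order_on V d" "P \<subseteq> d" "?D \<times> (V - ?D) \<subseteq> d"
    using linear_order_extension_downset[OF fin P sub(1)] by blast
  \<comment> \<open>The complement of an up-set is a down-set, so the same lemma yields an extension
    with \<open>?U\<close> on top.\<close>
  have "x \<in> V - ?U" if "(x, y) \<in> P" "y \<in> V - ?U" for x y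
    using that Pt[of _ x y] P0(1) by (auto simp: up_set_def)
  then obtain u where u: "linear_order_on V u" "P \<subseteq> u" "(V - ?U) \<times> (V - (V - ?U)) \<subseteq> u"
    using linear_order_extension_downset[OF fin P Diff_subset] by blast
  have "poset_dim V P \<le> card (K \<union> L \<union> {d, u})"
  proof (rule poset_dim_le_card[OF P])
    show "\<exists>l\<in>K \<union> L \<union> {d, u}. (x, y) \<notin> l" if xy: "x \<in> V" "y \<in> V" "(x, y) \<notin> P" for x y
    proof (cases "x \<in> ?D \<union> ?U \<and> y \<in> ?D \<union> ?U \<or> x \<in> V - S \<and> y \<in> V - S")
      case True
      then have "(\<exists>l\<in>K. (x, y) \<notin> l) \<or> (\<exists>l\<in>L. (x, y) \<notin> l)"
        using K(5) L(5) xy(3) by auto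
      then show ?thesis by auto
    next
      case False
      \<comment> \<open>A pair inside neither set has one point outside
        \<open>?D \<union> ?U\<close> and one point in \<open>S\<close>, which lies in both
        \<open>?D\<close> and \<open>?U\<close>.\<close>
      then consider "x \<in> S" "y \<notin> ?D" "y \<notin> ?U" | "y \<in> S" "x \<notin> ?D" "x \<notin> ?U"
        using xy sub by blast
      then show ?thesis
      proof cases
        case 1
        \<comment> \<open>Here \<open>x\<close> belongs to the top block \<open>?U\<close> of
          \<open>u\<close> and \<open>y\<close> does not.\<close>
        then have "(y, x) \<in> u" "x \<noteq> y" using u(3) sub xy by blast+
        then have "(x, y) \<notin> u" using linear_order_on_antisym[OF u(1), of y x] by simp
        then show ?thesis by simp
      next
        case 2
        \<comment> \<open>Here \<open>y\<close> belongs to the bottom block \<open>?D\<close> of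
          \<open>d\<close> and \<open>x\<close> does not.\<close>
        then have "(y, x) \<in> d" "x \<noteq> y" using d(3) sub xy by blast+
        then have "(x, y) \<notin> d" using linear_order_on_antisym[OF d(1), of y x] by simp
        then show ?thesis by simp
      qed
    qed
    show "linear_order_on V l \<and> P \<subseteq> l" if "l \<in> K \<union> L \<union> {d, u}" for l
      using that K(4) L(4) d(1,2) u(1,2) by auto
  qed (use K(1) L(1) in simp_all)
  also have "\<dots> \<le> card K + card L + card {d, u}"
    by (rule order_trans[OF card_Un_le add_le_mono1[OF card_Un_le]])
  also have "card {d, u} \<le> 2" by (simp add: card_insert_if)
  finally show ?thesis using K(2) L(2) by linarith
qed

lemma poset_dim_le_double:
  assumes fin: "finite V" and P: "partial_order_on V P" and S: "S \<subseteq> V"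
  shows "poset_dim V P
    \<le> 2 * (induced_dim P (down_set P S \<union> up_set P S) + induced_dim P (V - S))"
proof -
  let ?W = "down_set P S \<union> up_set P S"
  have W: "?W \<subseteq> V" "S \<subseteq> ?W" and PV: "subposet P V = P"
    using S partial_order_onD(4)[OF P] refl_onD[OF partial_order_onD(1)[OF P]]
    by (auto simp: down_set_def up_set_def subposet_def)
  \<comment> \<open>In the two extreme cases one of the summands is the dimension of
    \<open>P\<close> itself. Otherwise both ground sets are nonempty, so both summands are at least
    1 and absorb the extra 2.\<close>
  consider "S = {}" | "S = V" | "S \<noteq> {}" "S \<noteq> V" by blast
  then show ?thesis
  proof cases
    case 1
    then show ?thesis using PV by simp
  next
    case 2
    then have "?W = V" using W by blast
    then show ?thesis using PV by simp
  next
    case 3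
    have "induced_dim P ?W > 0"
      using 3 W poset_dim_pos[OF finite_subset[OF _ fin] partial_order_on_subposet[OF P]] by blast
    moreover have "induced_dim P (V - S) > 0"
      using 3 S poset_dim_pos[OF finite_subset[OF _ fin] partial_order_on_subposet[OF P]] by blast
    moreover have "p \<le> 2 * (a + b)" if "0 < a" "0 < b" "p \<le> a + b + 2" for a b p :: nat
      using that by arith
    ultimately show ?thesis using poset_dim_le_add_two[OF assms] by blast
  qed
qed

text \<open>Covering the points of \<open>V\<close> would not suffice: each non-pair must lie within
  a single set for a lifted realizer to miss it.\<close>

lemma poset_dim_le_three_cover:
  assumes fin: "finite V" and P: "partial_order_on V P"
    and XYZ: "X \<subseteq> V" "Y \<subseteq> V" "Z \<subseteq> V"
    and cover: "V \<times> V \<subseteq> X \<times> X \<union> Y \<times> Y \<union> Z \<times> Z"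
  shows "poset_dim V P \<le> induced_dim P X + induced_dim P Y + induced_dim P Z"
proof -
  obtain K where K: "finite K" "card K \<le> induced_dim P X" "X \<noteq> {} \<longrightarrow> K \<noteq> {}"
    "\<forall>l\<in>K. linear_order_on V l \<and> P \<subseteq> l"
    "\<forall>x\<in>X. \<forall>y\<in>X. (x, y) \<notin> P \<longrightarrow> (\<exists>l\<in>K. (x, y) \<notin> l)"
    by (rule realizer_of_subposet_lift[OF fin P XYZ(1)])
  obtain L where L: "finite L" "card L \<le> induced_dim P Y" "Y \<noteq> {} \<longrightarrow> L \<noteq> {}"
    "\<forall>l\<in>L. linear_order_on V l \<and> P \<subseteq> l"
    "\<forall>x\<in>Y. \<forall>y\<in>Y. (x, y) \<notin> P \<longrightarrow> (\<exists>l\<in>L. (x, y) \<notin> l)"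
    by (rule realizer_of_subposet_lift[OF fin P XYZ(2)])
  obtain M where M: "finite M" "card M \<le> induced_dim P Z" "Z \<noteq> {} \<longrightarrow> M \<noteq> {}"
    "\<forall>l\<in>M. linear_order_on V l \<and> P \<subseteq> l"
    "\<forall>x\<in>Z. \<forall>y\<in>Z. (x, y) \<notin> P \<longrightarrow> (\<exists>l\<in>M. (x, y) \<notin> l)"
    by (rule realizer_of_subposet_lift[OF fin P XYZ(3)])
  have "poset_dim V P \<le> card (K \<union> L \<union> M)"
  proof (rule poset_dim_le_card[OF P])
    show "K \<union> L \<union> M \<noteq> {}" if "V \<noteq> {}"
    proof -
      from that obtain x where "x \<in> V" by blast
      then have "x \<in> X \<or> x \<in> Y \<or> x \<in> Z" using cover by blast
      then show ?thesis using K(3) L(3) M(3) by (elim disjE) auto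
    qed
    show "\<exists>l\<in>K \<union> L \<union> M. (x, y) \<notin> l" if xy: "x \<in> V" "y \<in> V" "(x, y) \<notin> P" for x y
    proof -
      have "(x, y) \<in> X \<times> X \<union> Y \<times> Y \<union> Z \<times> Z" using xy(1,2) cover by auto
      then consider "x \<in> X" "y \<in> X" | "x \<in> Y" "y \<in> Y" | "x \<in> Z" "y \<in> Z"
        by auto
      then show ?thesis
      proof cases
        case 1 then show ?thesis using K(5) xy(3) by (simp add: bex_Un)
      next
        case 2 then show ?thesis using L(5) xy(3) by (simp add: bex_Un)
      next
        case 3 then show ?thesis using M(5) xy(3) by (simp add: bex_Un)
      qed
    qed
    show "linear_order_on V l \<and> P \<subseteq> l" if "l \<in> K \<union> L \<union> M" for l
      using that K(4) L(4) M(4) by blast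
  qed (use K(1) L(1) M(1) in simp_all)
  also have "\<dots> \<le> card K + card L + card M"
    by (rule order_trans[OF card_Un_le add_le_mono1[OF card_Un_le]])
  finally show ?thesis using K(2) L(2) M(2) by linarith
qed

theorem theorem1p8:
  fixes V :: "'a set" and P :: "'a rel" and S :: "'a set"
  assumes "finite V" and "partial_order_on V P" and "S \<subseteq> V"
  shows "poset_dim V P
           \<le> 2 * (induced_dim P (down_set P S \<union> up_set P S) + induced_dim P (V - S))
       \<and> induced_dim P (down_set P S \<union> up_set P S)
           \<le> induced_dim P (down_set P S) + induced_dim P (up_set P S)
             + induced_dim P ((down_set P S - S) \<union> (up_set P S - S))"
proof
  let ?D = "down_set P S" and ?U = "up_set P S"
  let ?W = "?D \<union> ?U" and ?Z = "(down_set P S - S) \<union> (up_set P S - S)"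
  show "poset_dim V P \<le> 2 * (induced_dim P ?W + induced_dim P (V - S))"
    by (rule poset_dim_le_double[OF assms])
  have sub: "?W \<subseteq> V" "S \<subseteq> ?D" "S \<subseteq> ?U"
    using assms(3) partial_order_onD(4)[OF assms(2)] refl_onD[OF partial_order_onD(1)[OF assms(2)]]
    by (auto simp: down_set_def up_set_def)
  \<comment> \<open>The ground set is now \<open>?W\<close>. A pair that meets \<open>S\<close> in
    one point has its other point in \<open>?D\<close> or \<open>?U\<close>, and the point of
    \<open>S\<close> is in both; a pair avoiding \<open>S\<close> lies in \<open>?Z\<close>.\<close>
  have "induced_dim P ?W \<le> induced_dim (subposet P ?W) ?D + induced_dim (subposet P ?W) ?U
      + induced_dim (subposet P ?W) ?Z"
    by (rule poset_dim_le_three_cover)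
      (use sub finite_subset[OF sub(1) assms(1)] partial_order_on_subposet[OF assms(2) sub(1)] in auto)
  moreover have "?D \<subseteq> ?W" "?U \<subseteq> ?W" "?Z \<subseteq> ?W" by auto
  ultimately show "induced_dim P ?W \<le> induced_dim P ?D + induced_dim P ?U + induced_dim P ?Z"
    by (simp only: subposet_subposet)
qed

end
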